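(* Every isonemal fabric of species $36_1$, $36_s$ or $39$ can be halved in all four possible ways, and each halving produces an isonemal prefabric whose symmetry group contains a group of Roth type $36_1$.
   Context: The plane $E$ is tessellated by unit squares called cells, with horizontal and vertical sides. The strands are the vertical columns of cells (warps) and the horizontal rows of cells (wefts). A prefabric assigns to each cell which of the two strands crossing there is uppermost; its design colours a cell dark if the warp is uppermost and pale if the weft is. A fabric is a prefabric that hangs together: its strands cannot be partitioned into two non-empty sets such that every strand of the first passes over every strand of the second wherever they cross. A symmetry is a pair $(g,\epsilon)$, where $g$ is an isometry of $E$ mapping the tessellation by cells to itself and $\epsilon\in\{e,\tau\}$: if $\epsilon=e$, $g$ carries the uppermost strand at each cell $c$ to the uppermost strand at $g(c)$; if $\epsilon=\tau$, $g$ carries the uppermost strand at $c$ to the lowermost strand at $g(c)$. The symmetries form the group $G$; $G_1$ is the planar group of all $g$ occurring in $G$. The prefabric is isonemal if $G$ is transitive on the strands. A rotation $g$ is called preserving if it is paired with $e$ and reversing if it is paired with $\tau$. Halving removes every other strand in each direction and widens the remaining strands uniformly to make a prefabric again: indexing cells by $\mathbb{Z}^2$, the design $D(i,j)$ becomes $D_{a,b}(i,j)=D(2i+a,2j+b)$, for one of the four choices $a,b\in\{0,1\}$. For a planar group of type $p4$, a lattice unit is a square whose side vectors generate the translation subgroup and whose corners are centres of quarter-turns (its centre is then also one, and the mid-points of its sides are centres of half-turns). A level-$1$ unit is a square on the hypotenuse of a right triangle with horizontal and vertical sides relatively prime positive integers of opposite parity, with corners all at cell corners or all at cell centres. A level-$2$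 unit is a square having the corners of a level-$1$ unit as the mid-points of its sides. A group of Roth type $36_1$ is a group of pairs $(g,\epsilon)$ whose planar projection is of type $p4$ with a level-$1$ lattice unit, in which all quarter-turns (at the centre and corners of the unit) are reversing (and the half-turns at the mid-points of the unit's sides are preserving). A prefabric is of species: $36_1$ if its full symmetry group is of Roth type $36_1$; $39$ if $G_1$ is of type $p4$ with a level-$1$ lattice unit, quarter-turns at cell centres reversing and those at cell corners preserving; $36_s$ if $G_1$ is of type $p4$ with a level-$2$ lattice unit with centre and corners at cell centres, all quarter-turns reversing. *)

theory Defs
  imports "HOL-Analysis.Analysis" "HOL-Algebra.Group"
begin

section \<open>The tessellated plane and its strands\<close>

text \<open>
  The plane is the type of complex numbers, with coordinates chosen so that the centres of the
  cells are the Gaussian integers.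
\<close>

definition cell :: "int \<Rightarrow> int \<Rightarrow> complex set" where
  "cell i j = cbox (Complex (of_int i - 1/2) (of_int j - 1/2))
                   (Complex (of_int i + 1/2) (of_int j + 1/2))"

definition cells :: "complex set set" where
  "cells = {cell i j | i j. True}"

definition warp :: "int \<Rightarrow> complex set" where
  "warp i = (\<Union>j. cell i j)"

definition weft :: "int \<Rightarrow> complex set" where
  "weft j = (\<Union>i. cell i j)"

definition strands :: "complex set set" where
  "strands = range warp \<union> range weft"

definition is_cell_centre :: "complex \<Rightarrow> bool" where
  "is_cell_centre z \<longleftrightarrow> Re z \<in> \<int> \<and> Im z \<in> \<int>"

definition is_cell_corner :: "complex \<Rightarrow> bool" where
  "is_cell_corner z \<longleftrightarrow> Re z - 1/2 \<in> \<int> \<and> Im z - 1/2 \<in> \<int>"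


section \<open>Prefabrics and fabrics\<close>

text \<open>
  A prefabric is given by its design: \<open>D i j\<close> holds iff the cell in column \<open>i\<close> and row \<open>j\<close>
  is dark, that is, iff the warp is uppermost there.
\<close>

type_synonym design = "int \<Rightarrow> int \<Rightarrow> bool"

definition upper :: "design \<Rightarrow> int \<Rightarrow> int \<Rightarrow> complex set" where
  "upper D i j = (if D i j then warp i else weft j)"

definition lower :: "design \<Rightarrow> int \<Rightarrow> int \<Rightarrow> complex set" where
  "lower D i j = (if D i j then weft j else warp i)"

text \<open>Vacuously true for parallel strands.\<close>

definition passes_over :: "design \<Rightarrow> complex set \<Rightarrow> complex set \<Rightarrow> bool" where
  "passes_over D s t \<longleftrightarrow> (\<forall>i j. {s, t} = {warp i, weft j} \<longrightarrow> upper D i j = s)"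

definition is_fabric :: "design \<Rightarrow> bool" where
  "is_fabric D \<longleftrightarrow>
     \<not> (\<exists>A B. A \<noteq> {} \<and> B \<noteq> {} \<and> A \<inter> B = {} \<and> A \<union> B = strands \<and>
            (\<forall>s\<in>A. \<forall>t\<in>B. passes_over D s t))"

definition halving :: "int \<Rightarrow> int \<Rightarrow> design \<Rightarrow> design" where
  "halving a b D = (\<lambda>i j. D (2 * i + a) (2 * j + b))"


section \<open>Symmetries\<close>

definition isometries :: "(complex \<Rightarrow> complex) set" where
  "isometries = {g. bij g \<and> (\<forall>x y. dist (g x) (g y) = dist x y)}"

definition isometry_group :: "(complex \<Rightarrow> complex) monoid" where
  "isometry_group = \<lparr>carrier = isometries, mult = (\<lambda>g h. g \<circ> h), one = id\<rparr>"

text \<open>\<open>Preserving\<close> and \<open>Reversing\<close> are the two values \<open>e\<close> and \<open>\<tau>\<close> of \<open>\<epsilon>\<close>.\<close>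

datatype side = Preserving | Reversing

definition side_mult :: "side \<Rightarrow> side \<Rightarrow> side" where
  "side_mult \<delta> \<epsilon> = (if \<delta> = \<epsilon> then Preserving else Reversing)"

definition preserves_cells :: "(complex \<Rightarrow> complex) \<Rightarrow> bool" where
  "preserves_cells g \<longleftrightarrow> (\<lambda>S. g ` S) ` cells = cells"

text \<open>The ambient group of all candidate symmetries \<open>(g, \<epsilon>)\<close>.\<close>

definition motion_group :: "((complex \<Rightarrow> complex) \<times> side) monoid" where
  "motion_group =
     \<lparr>carrier = {(g, \<epsilon>). g \<in> isometries \<and> preserves_cells g},
      mult = (\<lambda>(g, \<delta>) (h, \<epsilon>). (g \<circ> h, side_mult \<delta> \<epsilon>)),
      one = (id, Preserving)\<rparr>"

definition symmetries :: "design \<Rightarrow> ((complex \<Rightarrow> complex) \<times> side) set" where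
  "symmetries D =
     {(g, \<epsilon>). g \<in> isometries \<and> preserves_cells g \<and>
        (\<forall>i j k l. g ` cell i j = cell k l \<longrightarrow>
           g ` upper D i j = (case \<epsilon> of Preserving \<Rightarrow> upper D k l | Reversing \<Rightarrow> lower D k l))}"

definition planar_projection ::
  "((complex \<Rightarrow> complex) \<times> side) set \<Rightarrow> (complex \<Rightarrow> complex) set" where
  "planar_projection H = fst ` H"

definition isonemal :: "design \<Rightarrow> bool" where
  "isonemal D \<longleftrightarrow> (\<forall>s\<in>strands. \<forall>t\<in>strands. \<exists>(g, \<epsilon>)\<in>symmetries D. g ` s = t)"


section \<open>Planar groups of type p4\<close>

definition is_quarter_turn :: "complex \<Rightarrow> (complex \<Rightarrow> complex) \<Rightarrow> bool" where
  "is_quarter_turn c g \<longleftrightarrow>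
     g = (\<lambda>z. c + \<i> * (z - c)) \<or> g = (\<lambda>z. c - \<i> * (z - c))"

definition half_turn :: "complex \<Rightarrow> complex \<Rightarrow> complex" where
  "half_turn c = (\<lambda>z. c - (z - c))"

definition translation_vectors :: "(complex \<Rightarrow> complex) set \<Rightarrow> complex set" where
  "translation_vectors \<Gamma> = {t. (\<lambda>z. z + t) \<in> \<Gamma>}"

definition int_span :: "complex \<Rightarrow> complex \<Rightarrow> complex set" where
  "int_span u v = {of_int m * u + of_int n * v | m n. True}"

text \<open>
  Type p4: the translations form a lattice of rank two, and the linear parts of the elements
  form the cyclic group of order four consisting of rotations.
\<close>

definition type_p4 :: "(complex \<Rightarrow> complex) set \<Rightarrow> bool" where
  "type_p4 \<Gamma> \<longleftrightarrow>
     subgroup \<Gamma> isometry_group \<and>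
     (\<exists>u v. u \<noteq> v \<and> independent {u, v} \<and> translation_vectors \<Gamma> = int_span u v) \<and>
     (\<forall>g\<in>\<Gamma>. \<exists>\<omega>\<in>{1, \<i>, -1, -\<i>}. \<exists>t. g = (\<lambda>z. \<omega> * z + t)) \<and>
     (\<exists>t. (\<lambda>z. \<i> * z + t) \<in> \<Gamma>)"


section \<open>Lattice units and levels\<close>

text \<open>
  The square with a corner \<open>c\<close> and side vectors \<open>u\<close> and \<open>\<i> * u\<close>; every square is of this form.
\<close>

definition square_corners :: "complex \<Rightarrow> complex \<Rightarrow> complex set" where
  "square_corners c u = {c, c + u, c + u + \<i> * u, c + \<i> * u}"

definition square_midpoints :: "complex \<Rightarrow> complex \<Rightarrow> complex set" where
  "square_midpoints c u =
     {midpoint c (c + u), midpoint (c + u) (c + u + \<i> * u),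
      midpoint (c + u + \<i> * u) (c + \<i> * u), midpoint (c + \<i> * u) c}"

definition square_centre :: "complex \<Rightarrow> complex \<Rightarrow> complex" where
  "square_centre c u = midpoint c (c + u + \<i> * u)"

definition lattice_unit :: "(complex \<Rightarrow> complex) set \<Rightarrow> complex \<Rightarrow> complex \<Rightarrow> bool" where
  "lattice_unit \<Gamma> c u \<longleftrightarrow>
     translation_vectors \<Gamma> = int_span u (\<i> * u) \<and>
     (\<forall>z\<in>square_corners c u. \<exists>g\<in>\<Gamma>. is_quarter_turn z g)"

text \<open>
  A square with no horizontal side has, up to the choice of its base corner \<open>c\<close>, exactly one
  side vector \<open>u\<close> in the open first quadrant; so positive \<open>p\<close> and \<open>q\<close> cover all squares on
  hypotenuses, of rising and of falling slope.
\<close>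

definition level1_unit :: "complex \<Rightarrow> complex \<Rightarrow> bool" where
  "level1_unit c u \<longleftrightarrow>
     (\<exists>p q :: nat. p > 0 \<and> q > 0 \<and> coprime p q \<and> odd (p + q) \<and>
        u = Complex (of_nat p) (of_nat q)) \<and>
     ((\<forall>z\<in>square_corners c u. is_cell_corner z) \<or>
      (\<forall>z\<in>square_corners c u. is_cell_centre z))"

definition level2_unit :: "complex \<Rightarrow> complex \<Rightarrow> bool" where
  "level2_unit c u \<longleftrightarrow>
     (\<exists>c' u'. level1_unit c' u' \<and> square_midpoints c u = square_corners c' u')"


section \<open>Roth types and species\<close>

definition roth_type_36_1 :: "((complex \<Rightarrow> complex) \<times> side) set \<Rightarrow> bool" where
  "roth_type_36_1 H \<longleftrightarrow>
     subgroup H motion_group \<and>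
     type_p4 (planar_projection H) \<and>
     (\<exists>c u. level1_unit c u \<and> lattice_unit (planar_projection H) c u \<and>
        (\<forall>(g, \<epsilon>)\<in>H. \<forall>z. is_quarter_turn z g \<longrightarrow> \<epsilon> = Reversing) \<and>
        (\<forall>(g, \<epsilon>)\<in>H. \<forall>z\<in>square_midpoints c u. g = half_turn z \<longrightarrow> \<epsilon> = Preserving))"

definition species_36_1 :: "design \<Rightarrow> bool" where
  "species_36_1 D \<longleftrightarrow> roth_type_36_1 (symmetries D)"

definition species_39 :: "design \<Rightarrow> bool" where
  "species_39 D \<longleftrightarrow>
     type_p4 (planar_projection (symmetries D)) \<and>
     (\<exists>c u. level1_unit c u \<and> lattice_unit (planar_projection (symmetries D)) c u) \<and>
     (\<forall>(g, \<epsilon>)\<in>symmetries D. \<forall>z. is_quarter_turn z g \<longrightarrow>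
        (is_cell_centre z \<longrightarrow> \<epsilon> = Reversing) \<and> (is_cell_corner z \<longrightarrow> \<epsilon> = Preserving))"

definition species_36_s :: "design \<Rightarrow> bool" where
  "species_36_s D \<longleftrightarrow>
     type_p4 (planar_projection (symmetries D)) \<and>
     (\<exists>c u. level2_unit c u \<and> lattice_unit (planar_projection (symmetries D)) c u \<and>
        is_cell_centre (square_centre c u) \<and>
        (\<forall>z\<in>square_corners c u. is_cell_centre z)) \<and>
     (\<forall>(g, \<epsilon>)\<in>symmetries D. \<forall>z. is_quarter_turn z g \<longrightarrow> \<epsilon> = Reversing)"

end

theory Submission
  imports Defs
begin

text \<open>
  Cell centres are the Gaussian integers, so a design is a two-colouring of \<open>\<int>[\<i>]\<close>. A
  quarter-turn exchanges warps and wefts; hence one that is a reversing symmetry leaves the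
  colouring invariant, and a preserving one inverts it (\<open>turn_symmetry_iff\<close>).

  The three species have one thing in common. There are a vector \<open>u = p + q\<i>\<close>, with \<open>p\<close> and
  \<open>q\<close> coprime of opposite parity, and a cell centre \<open>c\<close> such that every point of
  \<open>c + u\<int>[\<i>]\<close> is the centre of a quarter-turn of \<open>G\<^sub>1\<close> (\<open>species_cell_quarter_turns\<close>). For
  a level-1 unit these are the corners of the units or their centres, whichever lie at cell
  centres; for a level-2 unit, whose lattice is \<open>(1 + \<i>)u\<int>[\<i>]\<close>, they are the corners and
  the centres together. All of these quarter-turns are reversing, so the colouring \<open>D\<close> is
  invariant under each of them. The product of one with the inverse of another is a translation,
  and in this way \<open>D\<close> is invariant under all translations by \<open>2u\<int>[\<i>]\<close>
  (\<open>quarter_turn_colour_period\<close>).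

  Write \<open>w = a + b\<i>\<close>; the halved colouring is \<open>E(z) = D(2z + w)\<close>. The period \<open>2u\<int>[\<i>]\<close> of
  \<open>D\<close> becomes the period \<open>u\<int>[\<i>]\<close> of \<open>E\<close>, with a level-1 unit. As the norm
  \<open>p\<^sup>2 + q\<^sup>2\<close> is odd, \<open>2\<close> is invertible modulo \<open>u\<close>, so some Gaussian integer \<open>c'\<close> has
  \<open>2c' + w\<close> in \<open>c + u\<int>[\<i>]\<close>; the quarter-turn of \<open>D\<close> about \<open>2c' + w\<close> becomes a quarter-turn of
  \<open>E\<close> about \<open>c'\<close> (\<open>halving_turn_group\<close>). This quarter-turn and the translations generate a
  group of Roth type \<open>36\<^sub>1\<close>. It is already transitive on the strands: because \<open>p\<close> and \<open>q\<close>
  are coprime, the vectors in \<open>u\<int>[\<i>]\<close> have all integers as real parts and as imaginary parts,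
  and the quarter-turn exchanges the two directions (\<open>isonemal_if_turn_group\<close>).
\<close>

section \<open>Gaussian integers and the colouring\<close>

lemma cell_centre_Complex [simp]: "is_cell_centre (Complex (of_int i) (of_int j))"
  by (simp add: is_cell_centre_def)

lemma cell_centre_cases:
  assumes "is_cell_centre z"
  obtains i j where "z = Complex (of_int i) (of_int j)"
  using assms unfolding is_cell_centre_def by (metis Ints_cases complex_surj)

lemma cell_centre_closed [simp, intro]:
  shows "is_cell_centre 0" "is_cell_centre 1" "is_cell_centre \<i>" "is_cell_centre (of_int n)"
    and "is_cell_centre x \<Longrightarrow> is_cell_centre y \<Longrightarrow> is_cell_centre (x + y)"
    and "is_cell_centre x \<Longrightarrow> is_cell_centre y \<Longrightarrow> is_cell_centre (x - y)"
    and "is_cell_centre x \<Longrightarrow> is_cell_centre y \<Longrightarrow> is_cell_centre (x * y)"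
    and "is_cell_centre x \<Longrightarrow> is_cell_centre (- x)"
    and "is_cell_centre x \<Longrightarrow> is_cell_centre (cnj x)"
  by (auto simp: is_cell_centre_def)

lemma cell_centre_numeral [simp]: "is_cell_centre (numeral n)"
  by (simp add: is_cell_centre_def)

lemma cell_centre_power [simp, intro]: "is_cell_centre x \<Longrightarrow> is_cell_centre (x ^ k)"
  by (induction k) auto

text \<open>
  The design as a function on the plane, so that it can be composed with isometries. Only its
  values at cell centres matter.
\<close>

definition colour :: "design \<Rightarrow> complex \<Rightarrow> bool" where
  "colour D z = D \<lfloor>Re z\<rfloor> \<lfloor>Im z\<rfloor>"

lemma colour_Complex [simp]: "colour D (Complex (of_int i) (of_int j)) = D i j"
  by (simp add: colour_def)

lemma colour_halving:
  assumes "is_cell_centre z"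
  shows "colour (halving a b D) z = colour D (2 * z + Complex (of_int a) (of_int b))"
proof -
  obtain i j where z: "z = Complex (of_int i) (of_int j)"
    using assms by (rule cell_centre_cases)
  have "2 * z + Complex (of_int a) (of_int b) = Complex (of_int (2 * i + a)) (of_int (2 * j + b))"
    by (simp add: z complex_eq_iff)
  then show ?thesis by (simp only: z colour_Complex) (simp add: halving_def)
qed

text \<open>
  The ideal generated by \<open>u\<close> in the Gaussian integers: a form of \<open>int_span u (\<i> * u)\<close> in which
  closure under quarter-turns is immediate.
\<close>

definition gauss_multiples :: "complex \<Rightarrow> complex set" where
  "gauss_multiples u = {u * x | x. is_cell_centre x}"

lemma gauss_multiplesI [intro]: "is_cell_centre x \<Longrightarrow> u * x \<in> gauss_multiples u"
  by (auto simp: gauss_multiples_def)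

lemma gauss_multiples_zero [simp, intro]: "0 \<in> gauss_multiples u"
  using gauss_multiplesI[of 0 u] by simp

lemma gauss_multiples_add [intro]:
  "\<lbrakk>l \<in> gauss_multiples u; m \<in> gauss_multiples u\<rbrakk> \<Longrightarrow> l + m \<in> gauss_multiples u"
  unfolding gauss_multiples_def by (auto simp flip: distrib_left)

lemma gauss_multiples_mult [intro]:
  "\<lbrakk>is_cell_centre x; l \<in> gauss_multiples u\<rbrakk> \<Longrightarrow> x * l \<in> gauss_multiples u"
  unfolding gauss_multiples_def by (auto simp: mult.left_commute)

lemma gauss_multiples_cell_centre:
  "\<lbrakk>is_cell_centre u; l \<in> gauss_multiples u\<rbrakk> \<Longrightarrow> is_cell_centre l"
  unfolding gauss_multiples_def by auto

lemma int_span_eq_gauss_multiples: "int_span u (\<i> * u) = gauss_multiples u"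
proof -
  have "of_int m * u + of_int n * (\<i> * u) = u * Complex (of_int m) (of_int n)" for m n
    by (simp add: complex_eq_iff algebra_simps)
  then show ?thesis
    unfolding int_span_def gauss_multiples_def by (metis cell_centre_Complex cell_centre_cases)
qed


section \<open>Turns acting on cells and strands\<close>

lemma cell_iff:
  "w \<in> cell i j \<longleftrightarrow> \<bar>Re w - of_int i\<bar> \<le> 1/2 \<and> \<bar>Im w - of_int j\<bar> \<le> 1/2"
proof -
  have "w \<in> cell i j \<longleftrightarrow> (of_int i - 1/2 \<le> Re w \<and> Re w \<le> of_int i + 1/2) \<and>
                        (of_int j - 1/2 \<le> Im w \<and> Im w \<le> of_int j + 1/2)"
    by (simp add: cell_def in_cbox_complex_iff)
  moreover have "\<bar>x - y\<bar> \<le> 1/2 \<longleftrightarrow> y - 1/2 \<le> x \<and> x \<le> y + 1/2" for x y :: real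
    by linarith
  ultimately show ?thesis by (simp only:)
qed

lemma exists_nearest_int: "\<exists>j :: int. \<bar>x - of_int j\<bar> \<le> (1/2 :: real)"
  using of_int_round_abs_le[of x] by (metis abs_minus_commute)

lemma warp_eq: "warp i = {w. \<bar>Re w - of_int i\<bar> \<le> 1/2}"
  using exists_nearest_int by (auto simp: warp_def cell_iff)

lemma weft_eq: "weft j = {w. \<bar>Im w - of_int j\<bar> \<le> 1/2}"
  using exists_nearest_int by (auto simp: weft_def cell_iff)

lemma warp_neq_weft: "warp i \<noteq> weft j"
proof
  assume "warp i = weft j"
  moreover have "Complex (of_int i) (of_int j + 1) \<in> warp i" by (simp add: warp_eq)
  ultimately show False by (simp add: weft_eq)
qed

lemma cell_eq_iff: "cell i j = cell k l \<longleftrightarrow> i = k \<and> j = l"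
proof
  assume eq: "cell i j = cell k l"
  have "Complex (of_int i + 1/2) (of_int j + 1/2) \<in> cell i j"
       "Complex (of_int i - 1/2) (of_int j - 1/2) \<in> cell i j"
    by (simp_all add: cell_iff)
  then show "i = k \<and> j = l" unfolding eq cell_iff complex.sel by linarith
qed auto

text \<open>
  The number \<open>k\<close> of right angles is a natural number, not a residue modulo four, so that its
  parity, which decides whether warps and wefts are exchanged, can be read off.
\<close>

definition turn :: "nat \<Rightarrow> complex \<Rightarrow> complex \<Rightarrow> complex" where
  "turn k t = (\<lambda>z. \<i> ^ k * z + t)"

definition turn_side :: "nat \<Rightarrow> side" where
  "turn_side k = (if even k then Preserving else Reversing)"

lemma cell_centre_turn [simp]:
  "is_cell_centre t \<Longrightarrow> is_cell_centre z \<Longrightarrow> is_cell_centre (turn k t z)"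
  by (auto simp: turn_def)

lemma i_power_four_mult [simp]: "\<i> ^ (4 * k) = 1"
  by (simp add: power_mult)

lemma i_power_mult_cancel: "\<i> ^ k * (\<i> ^ (3 * k) * x) = x"
proof -
  have "\<i> ^ k * (\<i> ^ (3 * k) * x) = \<i> ^ (4 * k) * x"
    by (simp flip: power_add mult.assoc)
  then show ?thesis by simp
qed

lemma turn_comp: "turn k t \<circ> turn k' t' = turn (k + k') (\<i> ^ k * t' + t)"
  by (simp add: turn_def fun_eq_iff power_add algebra_simps)

lemma turn_inverse: "turn (3 * k) (- (\<i> ^ (3 * k) * t)) \<circ> turn k t = id"
                    "turn k t \<circ> turn (3 * k) (- (\<i> ^ (3 * k) * t)) = id"
proof -
  have "3 * k + k = 4 * k" "k + 3 * k = 4 * k" by simp_all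
  then show "turn (3 * k) (- (\<i> ^ (3 * k) * t)) \<circ> turn k t = id"
            "turn k t \<circ> turn (3 * k) (- (\<i> ^ (3 * k) * t)) = id"
    unfolding turn_comp by (simp_all add: i_power_mult_cancel) (simp_all add: turn_def fun_eq_iff)
qed

lemma turn_isometry: "turn k t \<in> isometries"
proof -
  have "bij (turn k t)" using turn_inverse by (rule o_bij)
  moreover have "dist (turn k t x) (turn k t y) = dist x y" for x y
  proof -
    have "turn k t x - turn k t y = \<i> ^ k * (x - y)" by (simp add: turn_def algebra_simps)
    then show ?thesis by (simp add: dist_norm norm_mult norm_power)
  qed
  ultimately show ?thesis by (simp add: isometries_def)
qed

lemma abs_i_power_mult:
  "\<bar>Re (\<i> ^ k * x)\<bar> = (if even k then \<bar>Re x\<bar> else \<bar>Im x\<bar>)"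
  "\<bar>Im (\<i> ^ k * x)\<bar> = (if even k then \<bar>Im x\<bar> else \<bar>Re x\<bar>)"
  by (induction k) (auto simp: mult.assoc)

text \<open>
  Strands and cells are sets of points defined by inequalities; this reduces computing their
  images to substituting into these inequalities.
\<close>

lemma turn_image_Collect:
  assumes "\<And>w. Q (turn k t w) \<longleftrightarrow> P w"
  shows "turn k t ` {w. P w} = {w. Q w}"
proof -
  have "surj (turn k t)" using turn_isometry by (simp add: isometries_def bij_def)
  then show ?thesis using assms by (auto simp: image_iff) (metis surjD)
qed

lemma turn_image:
  assumes "turn k t (Complex (of_int i) (of_int j)) = Complex (of_int i') (of_int j')"
  shows "turn k t ` cell i j = cell i' j'"
    and "turn k t ` warp i = (if even k then warp i' else weft j')"
    and "turn k t ` weft j = (if even k then weft j' else warp i')"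
proof -
  have *: "turn k t w - Complex (of_int i') (of_int j') = \<i> ^ k * (w - Complex (of_int i) (of_int j))"
    for w unfolding assms[symmetric] by (simp add: turn_def algebra_simps)
  have R: "\<bar>Re (turn k t w) - of_int i'\<bar> = (if even k then \<bar>Re w - of_int i\<bar> else \<bar>Im w - of_int j\<bar>)"
   and I: "\<bar>Im (turn k t w) - of_int j'\<bar> = (if even k then \<bar>Im w - of_int j\<bar> else \<bar>Re w - of_int i\<bar>)"
    for w
    using abs_i_power_mult[of k "w - Complex (of_int i) (of_int j)"] unfolding *[symmetric] by simp_all
  have cell_Collect: "cell m n = {w. \<bar>Re w - of_int m\<bar> \<le> 1/2 \<and> \<bar>Im w - of_int n\<bar> \<le> 1/2}" for m n
    using cell_iff by blast
  show "turn k t ` cell i j = cell i' j'"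
    unfolding cell_Collect by (rule turn_image_Collect) (auto simp: R I)
  have "turn k t ` warp i = {w. if even k then \<bar>Re w - of_int i'\<bar> \<le> 1/2 else \<bar>Im w - of_int j'\<bar> \<le> 1/2}"
    unfolding warp_eq by (rule turn_image_Collect) (auto simp: R I)
  then show "turn k t ` warp i = (if even k then warp i' else weft j')"
    by (simp add: warp_eq weft_eq)
  have "turn k t ` weft j = {w. if even k then \<bar>Im w - of_int j'\<bar> \<le> 1/2 else \<bar>Re w - of_int i'\<bar> \<le> 1/2}"
    unfolding weft_eq by (rule turn_image_Collect) (auto simp: R I)
  then show "turn k t ` weft j = (if even k then weft j' else warp i')"
    by (simp add: warp_eq weft_eq)
qed

lemma turn_image_cells_subset:
  assumes "is_cell_centre t"
  shows "(\<lambda>S. turn k t ` S) ` cells \<subseteq> cells"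
proof clarify
  fix S assume "S \<in> cells"
  then obtain i j where S: "S = cell i j" by (auto simp: cells_def)
  have "is_cell_centre (turn k t (Complex (of_int i) (of_int j)))" using assms by simp
  then obtain i' j' where "turn k t (Complex (of_int i) (of_int j)) = Complex (of_int i') (of_int j')"
    by (rule cell_centre_cases)
  then show "turn k t ` S \<in> cells" by (auto simp: S turn_image(1) cells_def)
qed

lemma turn_preserves_cells:
  assumes "is_cell_centre t"
  shows "preserves_cells (turn k t)"
  unfolding preserves_cells_def
proof
  show "(\<lambda>S. turn k t ` S) ` cells \<subseteq> cells"
    using assms by (rule turn_image_cells_subset)
  show "cells \<subseteq> (\<lambda>S. turn k t ` S) ` cells"
  proof
    fix S assume S: "S \<in> cells"
    let ?h = "turn (3 * k) (- (\<i> ^ (3 * k) * t))"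
    have "?h ` S \<in> cells"
      using turn_image_cells_subset[of "- (\<i> ^ (3 * k) * t)" "3 * k"] S assms by blast
    moreover have "turn k t ` ?h ` S = S"
      by (simp add: image_comp turn_inverse)
    ultimately show "S \<in> (\<lambda>S. turn k t ` S) ` cells" by (metis imageI)
  qed
qed

text \<open>
  A turn by an odd number of right angles takes warps to wefts. If the warp is uppermost at a cell,
  a reversing symmetry makes its image, a weft, lowermost, so the warp is again uppermost at the
  image cell. Thus with \<open>turn_side k\<close> as second component the effects on directions and on
  sides cancel, and being a symmetry says only that the colours do not change.
\<close>

lemma turn_symmetry_iff:
  assumes t: "is_cell_centre t"
  shows "(turn k t, turn_side k) \<in> symmetries D \<longleftrightarrow>
         (\<forall>z. is_cell_centre z \<longrightarrow> colour D (turn k t z) = colour D z)"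
    (is "?sym \<longleftrightarrow> ?inv")
proof -
  let ?image = "\<lambda>i j. case turn_side k of Preserving \<Rightarrow> upper D i j | Reversing \<Rightarrow> lower D i j"
  have key: "turn k t ` upper D i j = ?image i' j' \<longleftrightarrow> D i' j' = D i j"
    if "turn k t (Complex (of_int i) (of_int j)) = Complex (of_int i') (of_int j')" for i j i' j'
    by (simp add: turn_image(2,3)[OF that] warp_neq_weft warp_neq_weft[symmetric]
        upper_def lower_def turn_side_def)
  have sym: "?sym \<longleftrightarrow>
    (\<forall>i j i' j'. turn k t ` cell i j = cell i' j' \<longrightarrow> turn k t ` upper D i j = ?image i' j')"
    using turn_isometry turn_preserves_cells[OF t] by (simp add: symmetries_def)
  have ex: "\<exists>i' j'. turn k t (Complex (of_int i) (of_int j)) = Complex (of_int i') (of_int j')" for i j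
    using cell_centre_turn[OF t, of "Complex (of_int i) (of_int j)" k] by (metis cell_centre_Complex cell_centre_cases)
  have cell: "turn k t ` cell i j = cell i' j' \<longleftrightarrow>
        turn k t (Complex (of_int i) (of_int j)) = Complex (of_int i') (of_int j')" for i j i' j'
  proof -
    obtain m n where mn: "turn k t (Complex (of_int i) (of_int j)) = Complex (of_int m) (of_int n)"
      using ex by blast
    show ?thesis by (simp add: turn_image(1)[OF mn] mn cell_eq_iff)
  qed
  have "?sym \<longleftrightarrow> (\<forall>i j i' j'. turn k t (Complex (of_int i) (of_int j)) = Complex (of_int i') (of_int j')
           \<longrightarrow> D i' j' = D i j)"
    unfolding sym cell by (simp add: key cong: imp_cong)
  also have "\<dots> \<longleftrightarrow> ?inv"
  proof
    assume H: "\<forall>i j i' j'. turn k t (Complex (of_int i) (of_int j)) = Complex (of_int i') (of_int j')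
           \<longrightarrow> D i' j' = D i j"
    have "colour D (turn k t z) = colour D z" if z: "is_cell_centre z" for z
    proof -
      obtain i j where ij: "z = Complex (of_int i) (of_int j)" using z by (rule cell_centre_cases)
      obtain i' j' where "turn k t z = Complex (of_int i') (of_int j')" using ex unfolding ij by blast
      then show ?thesis using H by (simp add: ij)
    qed
    then show ?inv by blast
  next
    assume inv: ?inv
    have "D i' j' = D i j"
      if "turn k t (Complex (of_int i) (of_int j)) = Complex (of_int i') (of_int j')" for i j i' j'
      using inv[rule_format, of "Complex (of_int i) (of_int j)"] that by simp
    then show "\<forall>i j i' j'. turn k t (Complex (of_int i) (of_int j)) = Complex (of_int i') (of_int j')
           \<longrightarrow> D i' j' = D i j" by blast
  qed
  finally show ?thesis .
qed


section \<open>The group generated by a quarter-turn and a lattice\<close>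

text \<open>
  All turns by multiples of a right angle about \<open>c\<close>, followed by translations by multiples of
  \<open>u\<close>: since \<open>c + \<i> ^ k * (z - c) = \<i> ^ k * z + (c - \<i> ^ k * c)\<close>, the translation part of the
  turn about \<open>c\<close> is \<open>c - \<i> ^ k * c\<close>.
\<close>

definition turn_group :: "complex \<Rightarrow> complex \<Rightarrow> ((complex \<Rightarrow> complex) \<times> side) set" where
  "turn_group c u =
     {(turn k (c - \<i> ^ k * c + l), turn_side k) | k l. l \<in> gauss_multiples u}"

lemma turn_groupI:
  "l \<in> gauss_multiples u \<Longrightarrow> t = c - \<i> ^ k * c + l \<Longrightarrow> (turn k t, turn_side k) \<in> turn_group c u"
  by (auto simp: turn_group_def)

lemma turn_groupE:
  assumes "x \<in> turn_group c u"
  obtains k l t where "x = (turn k t, turn_side k)" "t = c - \<i> ^ k * c + l" "l \<in> gauss_multiples u"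
  using assms by (auto simp: turn_group_def)

lemma turn_eq_iff: "turn k t = turn k' t' \<longleftrightarrow> \<i> ^ k = \<i> ^ k' \<and> t = t'"
proof
  assume eq: "turn k t = turn k' t'"
  then have "turn k t 0 = turn k' t' 0" "turn k t 1 = turn k' t' 1" by simp_all
  then show "\<i> ^ k = \<i> ^ k' \<and> t = t'" by (simp add: turn_def)
qed (simp add: turn_def)

lemma i_power_eq_imp_turn_side: "\<i> ^ k = \<i> ^ k' \<Longrightarrow> turn_side k = turn_side k'"
  using abs_i_power_mult(1)[of k 1] abs_i_power_mult(1)[of k' 1]
  by (auto simp: turn_side_def split: if_splits)

lemma i_power_in: "\<i> ^ k \<in> {1, \<i>, -1, -\<i>}"
  by (induction k) auto

lemma quarter_turn_iff:
  "is_quarter_turn c g \<longleftrightarrow> g = turn 1 (c - \<i> * c) \<or> g = turn 3 (c + \<i> * c)"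
proof -
  have "(\<lambda>z. c + \<i> * (z - c)) = turn 1 (c - \<i> * c)" "(\<lambda>z. c - \<i> * (z - c)) = turn 3 (c + \<i> * c)"
    by (simp_all add: turn_def fun_eq_iff algebra_simps eval_nat_numeral)
  then show ?thesis by (simp add: is_quarter_turn_def)
qed

lemma half_turn_eq: "half_turn c = turn 2 (2 * c)"
  by (simp add: half_turn_def turn_def fun_eq_iff)

lemma turn_side_add: "side_mult (turn_side k) (turn_side k') = turn_side (k + k')"
  by (auto simp: side_mult_def turn_side_def)

lemma translation_eq: "(\<lambda>z. z + t) = turn 0 t"
  by (simp add: turn_def)

lemma monoid_isometry_group: "monoid isometry_group"
  by (rule monoidI) (auto simp: isometry_group_def isometries_def bij_comp comp_assoc)

lemma preserves_cells_comp:
  assumes "preserves_cells g" "preserves_cells h"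
  shows "preserves_cells (g \<circ> h)"
proof -
  have "(\<lambda>S. (g \<circ> h) ` S) ` cells = (\<lambda>S. g ` S) ` (\<lambda>S. h ` S) ` cells"
    by (simp add: image_comp comp_def image_image)
  then show ?thesis using assms by (simp add: preserves_cells_def)
qed

lemma side_mult_monoid [simp]:
  "side_mult Preserving \<epsilon> = \<epsilon>" "side_mult \<epsilon> Preserving = \<epsilon>"
  "side_mult (side_mult \<delta> \<epsilon>) \<phi> = side_mult \<delta> (side_mult \<epsilon> \<phi>)"
  by (cases \<delta>; cases \<epsilon>; cases \<phi>; simp add: side_mult_def)+

lemma monoid_motion_group: "monoid motion_group"
proof (rule monoidI)
  show "x \<otimes>\<^bsub>motion_group\<^esub> y \<in> carrier motion_group"
    if "x \<in> carrier motion_group" "y \<in> carrier motion_group" for x y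
    using that by (auto simp: motion_group_def isometries_def bij_comp preserves_cells_comp)
  show "\<one>\<^bsub>motion_group\<^esub> \<in> carrier motion_group"
    by (auto simp: motion_group_def isometries_def preserves_cells_def)
qed (auto simp: motion_group_def comp_assoc)

text \<open>
  In a monoid a two-sided inverse is unique, so exhibiting one inside \<open>H\<close> identifies it with
  \<open>inv\<close>. This serves both for the pairs and for their planar projection.
\<close>

lemma subgroupI_monoid:
  assumes "monoid G" "H \<subseteq> carrier G" "\<one>\<^bsub>G\<^esub> \<in> H"
    and "\<And>x y. x \<in> H \<Longrightarrow> y \<in> H \<Longrightarrow> x \<otimes>\<^bsub>G\<^esub> y \<in> H"
    and inverse: "\<And>x. x \<in> H \<Longrightarrow> \<exists>y\<in>H. x \<otimes>\<^bsub>G\<^esub> y = \<one>\<^bsub>G\<^esub> \<and> y \<otimes>\<^bsub>G\<^esub> x = \<one>\<^bsub>G\<^esub>"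
  shows "subgroup H G"
proof
  show "inv\<^bsub>G\<^esub> x \<in> H" if x: "x \<in> H" for x
  proof -
    obtain y where y: "y \<in> H" "x \<otimes>\<^bsub>G\<^esub> y = \<one>\<^bsub>G\<^esub>" "y \<otimes>\<^bsub>G\<^esub> x = \<one>\<^bsub>G\<^esub>"
      using inverse[OF x] by blast
    then have "inv\<^bsub>G\<^esub> x = y"
      unfolding m_inv_def using x assms(2) monoid.inv_unique[OF assms(1)]
      by (intro the_equality) blast+
    then show ?thesis using y by simp
  qed
qed (use assms in auto)

lemma turn_group_subset:
  assumes c: "is_cell_centre c" and u: "is_cell_centre u"
  shows "turn_group c u \<subseteq> carrier motion_group"
proof
  fix x assume "x \<in> turn_group c u"
  then obtain k l t where "x = (turn k t, turn_side k)" "t = c - \<i> ^ k * c + l" "l \<in> gauss_multiples u"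
    by (rule turn_groupE)
  then show "x \<in> carrier motion_group"
    using c gauss_multiples_cell_centre[OF u]
    by (simp add: motion_group_def turn_isometry turn_preserves_cells)
qed

lemma turn_group_closed:
  assumes x: "x \<in> turn_group c u" and y: "y \<in> turn_group c u"
  shows "x \<otimes>\<^bsub>motion_group\<^esub> y \<in> turn_group c u"
proof -
  obtain k l t where x: "x = (turn k t, turn_side k)" "t = c - \<i> ^ k * c + l" "l \<in> gauss_multiples u"
    using x by (rule turn_groupE)
  obtain k' l' t' where y: "y = (turn k' t', turn_side k')" "t' = c - \<i> ^ k' * c + l'" "l' \<in> gauss_multiples u"
    using y by (rule turn_groupE)
  have "l + \<i> ^ k * l' \<in> gauss_multiples u" using x y by blast
  then have "(turn (k + k') (\<i> ^ k * t' + t), turn_side (k + k')) \<in> turn_group c u"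
    by (rule turn_groupI) (simp add: x y power_add algebra_simps)
  then show ?thesis by (simp add: x(1) y(1) motion_group_def turn_comp turn_side_add)
qed

lemma turn_group_one: "\<one>\<^bsub>motion_group\<^esub> \<in> turn_group c u"
  using turn_groupI[of 0 u 0 c 0] by (simp add: motion_group_def turn_def turn_side_def id_def)

lemma turn_group_inverse:
  assumes x: "x \<in> turn_group c u"
  shows "\<exists>y\<in>turn_group c u. x \<otimes>\<^bsub>motion_group\<^esub> y = \<one>\<^bsub>motion_group\<^esub> \<and>
                            y \<otimes>\<^bsub>motion_group\<^esub> x = \<one>\<^bsub>motion_group\<^esub>"
proof -
  obtain k l t where x': "x = (turn k t, turn_side k)" "t = c - \<i> ^ k * c + l" "l \<in> gauss_multiples u"
    using x by (rule turn_groupE)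
  let ?y = "(turn (3 * k) (- (\<i> ^ (3 * k) * t)), turn_side (3 * k))"
  have "(- (\<i> ^ (3 * k))) * l \<in> gauss_multiples u" using x'(3) by blast
  moreover have "\<i> ^ (3 * k) * (\<i> ^ k * c) = c"
    using i_power_mult_cancel[of k c] by (simp add: mult.left_commute)
  ultimately have "?y \<in> turn_group c u"
    by (intro turn_groupI) (auto simp: x' algebra_simps)
  moreover have "x \<otimes>\<^bsub>motion_group\<^esub> ?y = \<one>\<^bsub>motion_group\<^esub> \<and> ?y \<otimes>\<^bsub>motion_group\<^esub> x = \<one>\<^bsub>motion_group\<^esub>"
    by (simp add: x'(1) motion_group_def turn_inverse turn_side_add) (simp add: turn_side_def)
  ultimately show ?thesis by blast
qed

lemma turn_group_subgroup:
  assumes "is_cell_centre c" and "is_cell_centre u"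
  shows "subgroup (turn_group c u) motion_group"
  using monoid_motion_group turn_group_subset[OF assms] turn_group_one turn_group_closed
    turn_group_inverse by (rule subgroupI_monoid)

lemma turn_group_projection_subgroup:
  assumes "is_cell_centre c" and "is_cell_centre u"
  shows "subgroup (planar_projection (turn_group c u)) isometry_group"
  unfolding planar_projection_def
proof (rule subgroupI_monoid[OF monoid_isometry_group])
  have mult: "fst x \<otimes>\<^bsub>isometry_group\<^esub> fst y = fst (x \<otimes>\<^bsub>motion_group\<^esub> y)" for x y
    by (cases x; cases y) (simp add: isometry_group_def motion_group_def)
  have one: "\<one>\<^bsub>isometry_group\<^esub> = fst \<one>\<^bsub>motion_group\<^esub>"
    by (simp add: isometry_group_def motion_group_def)
  show "fst ` turn_group c u \<subseteq> carrier isometry_group"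
    by (auto simp: turn_group_def isometry_group_def turn_isometry)
  show "\<one>\<^bsub>isometry_group\<^esub> \<in> fst ` turn_group c u"
    using turn_group_one unfolding one by (rule imageI)
  show "g \<otimes>\<^bsub>isometry_group\<^esub> h \<in> fst ` turn_group c u"
    if "g \<in> fst ` turn_group c u" "h \<in> fst ` turn_group c u" for g h
    using that turn_group_closed by (clarify, unfold mult) (intro imageI)
  show "\<exists>h\<in>fst ` turn_group c u. g \<otimes>\<^bsub>isometry_group\<^esub> h = \<one>\<^bsub>isometry_group\<^esub> \<and>
                                 h \<otimes>\<^bsub>isometry_group\<^esub> g = \<one>\<^bsub>isometry_group\<^esub>"
    if g: "g \<in> fst ` turn_group c u" for g
  proof -
    obtain x where x: "g = fst x" "x \<in> turn_group c u" using g by (elim imageE)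
    then obtain y where "y \<in> turn_group c u" "x \<otimes>\<^bsub>motion_group\<^esub> y = \<one>\<^bsub>motion_group\<^esub>"
        "y \<otimes>\<^bsub>motion_group\<^esub> x = \<one>\<^bsub>motion_group\<^esub>"
      using turn_group_inverse by blast
    then show ?thesis by (intro bexI[of _ "fst y"]) (auto simp: x mult one)
  qed
qed

lemma planar_projectionI: "(g, \<epsilon>) \<in> H \<Longrightarrow> g \<in> planar_projection H"
  unfolding planar_projection_def by (metis fst_conv imageI)

lemma turn_group_translation_vectors:
  "translation_vectors (planar_projection (turn_group c u)) = int_span u (\<i> * u)"
proof -
  have "t \<in> translation_vectors (planar_projection (turn_group c u)) \<longleftrightarrow> t \<in> gauss_multiples u" for t
  proof
    assume "t \<in> translation_vectors (planar_projection (turn_group c u))"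
    then have "turn 0 t \<in> fst ` turn_group c u"
      by (simp add: translation_vectors_def planar_projection_def translation_eq)
    then obtain k l where "turn 0 t = turn k (c - \<i> ^ k * c + l)" "l \<in> gauss_multiples u"
      by (auto simp: turn_group_def)
    moreover from this have "\<i> ^ k = 1" by (simp add: turn_eq_iff)
    ultimately show "t \<in> gauss_multiples u" by (simp add: turn_eq_iff)
  next
    assume "t \<in> gauss_multiples u"
    then have "(turn 0 t, turn_side 0) \<in> turn_group c u"
      by (rule turn_groupI) simp
    then have "turn 0 t \<in> planar_projection (turn_group c u)"
      by (rule planar_projectionI)
    then show "t \<in> translation_vectors (planar_projection (turn_group c u))"
      by (simp add: translation_vectors_def translation_eq)
  qed
  then show ?thesis by (auto simp: int_span_eq_gauss_multiples)
qed

lemma turn_group_quarter_turn: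
  assumes "t \<in> gauss_multiples u"
  shows "(turn 1 (c - \<i> * c + t), Reversing) \<in> turn_group c u"
  using turn_groupI[OF assms, of "c - \<i> * c + t" c 1] by (simp add: turn_side_def)

lemma turn_group_type_p4:
  assumes "is_cell_centre c" and "is_cell_centre u" and "u \<noteq> 0"
  shows "type_p4 (planar_projection (turn_group c u))"
  unfolding type_p4_def
proof (intro conjI)
  show "subgroup (planar_projection (turn_group c u)) isometry_group"
    using assms by (intro turn_group_projection_subgroup)
  have "u \<noteq> \<i> * u" using \<open>u \<noteq> 0\<close> by (auto simp: complex_eq_iff)
  have "independent {u, \<i> * u}"
    using \<open>u \<noteq> 0\<close> by (intro pairwise_orthogonal_independent)
      (auto simp: pairwise_def orthogonal_def inner_complex_def)
  then show "\<exists>v w. v \<noteq> w \<and> independent {v, w} \<and>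
      translation_vectors (planar_projection (turn_group c u)) = int_span v w"
    proof (intro exI conjI)
    show "u \<noteq> \<i> * u" by fact
  qed (simp_all add: turn_group_translation_vectors)
  show "\<forall>g\<in>planar_projection (turn_group c u). \<exists>\<omega>\<in>{1, \<i>, -1, -\<i>}. \<exists>t. g = (\<lambda>z. \<omega> * z + t)"
  proof
    fix g assume "g \<in> planar_projection (turn_group c u)"
    then obtain k t where "g = (\<lambda>z. \<i> ^ k * z + t)"
      by (auto simp: planar_projection_def turn_group_def turn_def)
    then show "\<exists>\<omega>\<in>{1, \<i>, -1, -\<i>}. \<exists>t. g = (\<lambda>z. \<omega> * z + t)"
      using i_power_in[of k] by (intro bexI[of _ "\<i> ^ k"] exI[of _ t])
  qed
  have "turn 1 (c - \<i> * c + 0) \<in> planar_projection (turn_group c u)"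
    by (rule planar_projectionI[OF turn_group_quarter_turn]) simp
  then show "\<exists>t. (\<lambda>z. \<i> * z + t) \<in> planar_projection (turn_group c u)"
    unfolding turn_def power_one_right by (rule exI)
qed

text \<open>
  The translation by \<open>(1 - \<i>)ux\<close> after the quarter-turn about \<open>c\<close> is a quarter-turn about
  \<open>c + ux\<close>, which provides the quarter-turns at the corners of the unit. An element of the
  group determines \<open>k\<close> modulo four, so a quarter-turn can occur only with odd \<open>k\<close> and a
  half-turn only with even \<open>k\<close>, which fixes their sides.
\<close>

lemma turn_group_roth_type_36_1:
  assumes c: "is_cell_centre c" and u: "is_cell_centre u" and unit: "level1_unit c u"
  shows "roth_type_36_1 (turn_group c u)"
  unfolding roth_type_36_1_def
proof (intro conjI)
  have "u \<noteq> 0" using unit by (auto simp: level1_unit_def complex_eq_iff)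
  then show "type_p4 (planar_projection (turn_group c u))"
    using c u by (intro turn_group_type_p4)
  show "subgroup (turn_group c u) motion_group"
    using c u by (rule turn_group_subgroup)
  have lattice: "lattice_unit (planar_projection (turn_group c u)) c u"
    unfolding lattice_unit_def
  proof (intro conjI ballI)
    show "translation_vectors (planar_projection (turn_group c u)) = int_span u (\<i> * u)"
      by (rule turn_group_translation_vectors)
    fix z assume "z \<in> square_corners c u"
    then have "z \<in> (\<lambda>x. c + u * x) ` {0, 1, 1 + \<i>, \<i>}"
      by (simp add: square_corners_def algebra_simps)
    moreover have "\<forall>x\<in>{0, 1, 1 + \<i>, \<i>}. is_cell_centre x"
      by (simp add: is_cell_centre_def)
    ultimately obtain x where x: "is_cell_centre x" "z = c + u * x"
      by blast
    have "u * (x - \<i> * x) \<in> gauss_multiples u" using x by blast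
    then have "(turn 1 (z - \<i> * z), Reversing) \<in> turn_group c u"
      using turn_group_quarter_turn[of "u * (x - \<i> * x)" u c] by (simp add: x algebra_simps)
    then show "\<exists>g\<in>planar_projection (turn_group c u). is_quarter_turn z g"
      using planar_projectionI quarter_turn_iff by blast
  qed
  have side: "\<epsilon> = turn_side k" if x: "(turn k t, \<epsilon>) \<in> turn_group c u" for k t \<epsilon>
  proof -
    obtain k' t' where "turn k t = turn k' t'" "\<epsilon> = turn_side k'"
      using x by (elim turn_groupE) simp
    then show ?thesis unfolding turn_eq_iff by (metis i_power_eq_imp_turn_side)
  qed
  have reversing: "\<epsilon> = Reversing" if x: "(g, \<epsilon>) \<in> turn_group c u" "is_quarter_turn z g" for g \<epsilon> z
    using x(2) unfolding quarter_turn_iff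
  proof
    assume "g = turn 1 (z - \<i> * z)"
    then show ?thesis using side[of 1 _ \<epsilon>] x(1) by (simp add: turn_side_def)
  next
    assume "g = turn 3 (z + \<i> * z)"
    then show ?thesis using side[of 3 _ \<epsilon>] x(1) by (simp add: turn_side_def)
  qed
  have preserving: "\<epsilon> = Preserving" if "(half_turn z, \<epsilon>) \<in> turn_group c u" for z \<epsilon>
    using side[of 2 "2 * z" \<epsilon>] that by (simp add: half_turn_eq turn_side_def)
  show "\<exists>c' u'. level1_unit c' u' \<and> lattice_unit (planar_projection (turn_group c u)) c' u' \<and>
      (\<forall>(g, \<epsilon>)\<in>turn_group c u. \<forall>z. is_quarter_turn z g \<longrightarrow> \<epsilon> = Reversing) \<and>
      (\<forall>(g, \<epsilon>)\<in>turn_group c u. \<forall>z\<in>square_midpoints c' u'. g = half_turn z \<longrightarrow> \<epsilon> = Preserving)"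
  proof (intro exI conjI)
    show "level1_unit c u" by (rule unit)
    show "lattice_unit (planar_projection (turn_group c u)) c u" by (rule lattice)
    show "\<forall>(g, \<epsilon>)\<in>turn_group c u. \<forall>z. is_quarter_turn z g \<longrightarrow> \<epsilon> = Reversing"
      by (intro ballI case_prodI2 allI impI, rule reversing) simp_all
    show "\<forall>(g, \<epsilon>)\<in>turn_group c u. \<forall>z\<in>square_midpoints c u. g = half_turn z \<longrightarrow> \<epsilon> = Preserving"
      by (intro ballI case_prodI2 impI, rule preserving) simp_all
  qed
qed

text \<open>
  Every element of the group is a power of one quarter-turn followed by a translation, so
  invariance under these generators is enough.
\<close>

lemma turn_group_symmetries:
  assumes c: "is_cell_centre c" and u: "is_cell_centre u"
    and quarter: "\<And>z. is_cell_centre z \<Longrightarrow> colour E (c + \<i> * (z - c)) = colour E z"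
    and period: "\<And>z l. is_cell_centre z \<Longrightarrow> l \<in> gauss_multiples u \<Longrightarrow> colour E (z + l) = colour E z"
  shows "turn_group c u \<subseteq> symmetries E"
proof
  fix x assume "x \<in> turn_group c u"
  then obtain k l t where x: "x = (turn k t, turn_side k)" "t = c - \<i> ^ k * c + l" "l \<in> gauss_multiples u"
    by (rule turn_groupE)
  have "is_cell_centre t" using x c gauss_multiples_cell_centre[OF u] by auto
  moreover have "colour E (turn k t z) = colour E z" if z: "is_cell_centre z" for z
  proof -
    have pow: "is_cell_centre (c + \<i> ^ k * (z - c)) \<and> colour E (c + \<i> ^ k * (z - c)) = colour E z" for k
    proof (induction k)
      case (Suc k)
      have "is_cell_centre (c + \<i> ^ Suc k * (z - c))"
        using c z by (intro cell_centre_closed cell_centre_power)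
      moreover have "c + \<i> ^ Suc k * (z - c) = c + \<i> * (c + \<i> ^ k * (z - c) - c)" by simp
      ultimately show ?case using Suc quarter[of "c + \<i> ^ k * (z - c)"] by (simp only: simp_thms)
    qed (use z in auto)
    have "turn k t z = c + \<i> ^ k * (z - c) + l" by (simp add: turn_def x algebra_simps)
    then show ?thesis using pow[of k] period x(3) by simp
  qed
  ultimately show "x \<in> symmetries E" by (simp add: x turn_symmetry_iff)
qed


section \<open>Transitivity on the strands\<close>

text \<open>
  The real part of \<open>(p + q\<i>)(x - y\<i>)\<close> is \<open>px + qy\<close>, which takes every integer value by the
  identity of Bezout; multiplication by \<open>\<i>\<close> transfers this to imaginary parts.
\<close>

lemma gauss_multiples_coordinate:
  fixes p q :: int and d :: int
  assumes "coprime p q"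
  obtains l m where "l \<in> gauss_multiples (Complex (of_int p) (of_int q))" "Re l = of_int d"
    and "m \<in> gauss_multiples (Complex (of_int p) (of_int q))" "Im m = of_int d"
proof -
  let ?u = "Complex (of_int p) (of_int q)"
  obtain a b where ab: "a * p + b * q = 1"
    using bezout_int[of p q] unfolding coprime_imp_gcd_eq_1[OF assms] by (elim exE)
  define l where "l = ?u * Complex (of_int (d * a)) (of_int (- d * b))"
  have "Re l = of_int (d * (a * p + b * q))" by (simp add: l_def algebra_simps)
  then have Re: "Re l = of_int d" using ab by simp
  have l: "l \<in> gauss_multiples ?u"
    unfolding l_def by (rule gauss_multiplesI) (rule cell_centre_Complex)
  show ?thesis
  proof (rule that[of l "\<i> * l"])
    show "\<i> * l \<in> gauss_multiples ?u"
      using l by (intro gauss_multiples_mult) simp_all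
    show "Im (\<i> * l) = of_int d" using Re by simp
  qed (rule l, rule Re)
qed

text \<open>
  A strand is determined by one coordinate, and a suitable translation gives this coordinate any
  prescribed value. Even \<open>k\<close> serves two strands of the same direction and odd \<open>k\<close> two of
  different directions.
\<close>

lemma isonemal_if_turn_group:
  fixes p q :: int
  assumes c: "is_cell_centre c" and "coprime p q" and u: "u = Complex (of_int p) (of_int q)"
    and sub: "turn_group c u \<subseteq> symmetries E"
  shows "isonemal E"
proof -
  have u': "is_cell_centre u" by (simp add: u)
  have target: "(\<exists>(g, \<epsilon>)\<in>symmetries E. g ` warp m = (if even k then warp n else weft n)) \<and>
                (\<exists>(g, \<epsilon>)\<in>symmetries E. g ` weft m = (if even k then weft n else warp n))" for k :: nat and m n
  proof -
    define g where "g l = turn k (c - \<i> ^ k * c + l)" for l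
    have g_sym: "\<exists>(h, \<epsilon>)\<in>symmetries E. h ` S = g l ` S" if "l \<in> gauss_multiples u" for l S
      using sub turn_groupI[OF that refl, of k c] by (auto simp: g_def)
    define z where "z = Complex (of_int m) (of_int m)"
    have "is_cell_centre (g 0 z)" using c by (auto simp: g_def z_def)
    then obtain y1 y2 where y: "g 0 z = Complex (of_int y1) (of_int y2)" by (rule cell_centre_cases)
    obtain l1 where l1: "l1 \<in> gauss_multiples u" "Re l1 = of_int (n - y1)"
      using gauss_multiples_coordinate[OF \<open>coprime p q\<close>, of "n - y1"] unfolding u by blast
    obtain l2 where l2: "l2 \<in> gauss_multiples u" "Im l2 = of_int (n - y2)"
      using gauss_multiples_coordinate[OF \<open>coprime p q\<close>, of "n - y2"] unfolding u by blast
    have shift: "g l z = g 0 z + l" for l by (simp add: g_def turn_def)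
    obtain r1 where "g l1 z = Complex (of_int n) (of_int r1)"
    proof -
      obtain i j where "l1 = Complex (of_int i) (of_int j)"
        using gauss_multiples_cell_centre[OF u' l1(1)] by (rule cell_centre_cases)
      then have "g l1 z = Complex (of_int n) (of_int (y2 + j))"
        using l1(2) unfolding shift[of l1] y by (simp add: complex_eq_iff)
      then show ?thesis by (rule that)
    qed
    then have z1: "turn k (c - \<i> ^ k * c + l1) (Complex (of_int m) (of_int m)) = Complex (of_int n) (of_int r1)"
      by (simp add: g_def z_def)
    have 1: "g l1 ` warp m = (if even k then warp n else weft r1)"
                 "g l1 ` weft m = (if even k then weft r1 else warp n)"
      unfolding g_def z_def using turn_image(2,3)[OF z1] by simp_all
    obtain r2 where "g l2 z = Complex (of_int r2) (of_int n)"
    proof -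
      obtain i j where "l2 = Complex (of_int i) (of_int j)"
        using gauss_multiples_cell_centre[OF u' l2(1)] by (rule cell_centre_cases)
      then have "g l2 z = Complex (of_int (y1 + i)) (of_int n)"
        using l2(2) unfolding shift[of l2] y by (simp add: complex_eq_iff)
      then show ?thesis by (rule that)
    qed
    then have z2: "turn k (c - \<i> ^ k * c + l2) (Complex (of_int m) (of_int m)) = Complex (of_int r2) (of_int n)"
      by (simp add: g_def z_def)
    have 2: "g l2 ` warp m = (if even k then warp r2 else weft n)"
                 "g l2 ` weft m = (if even k then weft n else warp r2)"
      unfolding g_def z_def using turn_image(2,3)[OF z2] by simp_all
    show ?thesis using g_sym[OF l1(1), of "warp m"] g_sym[OF l1(1), of "weft m"]
        g_sym[OF l2(1), of "warp m"] g_sym[OF l2(1), of "weft m"] 1 2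
      by (cases "even k") simp_all
  qed
  show ?thesis
    unfolding isonemal_def
  proof (intro ballI)
    fix S T assume "S \<in> strands" "T \<in> strands"
    then obtain m n where "S = warp m \<or> S = weft m" "T = warp n \<or> T = weft n"
      unfolding strands_def by blast
    then show "\<exists>(g, \<epsilon>)\<in>symmetries E. g ` S = T"
      using target[of m 0 n] target[of m 1 n] by (elim disjE) simp_all
  qed
qed


section \<open>Quarter-turns of a halved design\<close>

text \<open>
  Invariance under a quarter-turn and under its inverse is the same, so the sense of rotation
  may be normalised.
\<close>

lemma reversing_quarter_turn_colour:
  assumes c: "is_cell_centre c" and g: "is_quarter_turn c g" "(g, Reversing) \<in> symmetries D"
    and z: "is_cell_centre z"
  shows "colour D (c + \<i> * (z - c)) = colour D z"
  using g(1) unfolding quarter_turn_iff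
proof
  assume "g = turn 1 (c - \<i> * c)"
  then have "(turn 1 (c - \<i> * c), turn_side 1) \<in> symmetries D"
    using g(2) by (simp add: turn_side_def)
  moreover have "is_cell_centre (c - \<i> * c)" using c by simp
  ultimately have "colour D (turn 1 (c - \<i> * c) z) = colour D z"
    using z by (simp only: turn_symmetry_iff)
  then show ?thesis by (simp add: turn_def algebra_simps)
next
  assume "g = turn 3 (c + \<i> * c)"
  then have "(turn 3 (c + \<i> * c), turn_side 3) \<in> symmetries D"
    using g(2) by (simp add: turn_side_def)
  moreover have "is_cell_centre (c + \<i> * c)" using c by simp
  moreover have "is_cell_centre (c + \<i> * (z - c))" using c z by simp
  ultimately have "colour D (turn 3 (c + \<i> * c) (c + \<i> * (z - c))) = colour D (c + \<i> * (z - c))"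
    by (simp only: turn_symmetry_iff)
  moreover have "turn 3 (c + \<i> * c) (c + \<i> * (z - c)) = z"
    by (simp add: turn_def algebra_simps eval_nat_numeral)
  ultimately show ?thesis by simp
qed

text \<open>
  The quarter-turn about \<open>c + m\<close> after the inverse of the one about \<open>c\<close> is the translation by
  \<open>(1 - \<i>)m\<close>. Taking \<open>m = (1 + \<i>)l\<close> gives \<open>2l\<close>.
\<close>

lemma quarter_turn_colour_period:
  assumes c: "is_cell_centre c" and u: "is_cell_centre u"
    and quarter: "\<And>z l. is_cell_centre z \<Longrightarrow> l \<in> gauss_multiples u \<Longrightarrow>
                    colour D (c + l + \<i> * (z - (c + l))) = colour D z"
    and z: "is_cell_centre z" and l: "l \<in> gauss_multiples u"
  shows "colour D (z + 2 * l) = colour D z"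
proof -
  let ?m = "(1 + \<i>) * l"
  have m: "?m \<in> gauss_multiples u"
    using l by (intro gauss_multiples_mult cell_centre_closed)
  \<comment> \<open>The point that the quarter-turn about \<open>c\<close> takes to \<open>z\<close>.\<close>
  define y where "y = c - \<i> * (z - c)"
  have y: "is_cell_centre y" unfolding y_def using c z by (intro cell_centre_closed)
  have "c + ?m + \<i> * (y - (c + ?m)) = z + 2 * l"
    by (simp add: y_def algebra_simps)
  then have "colour D (z + 2 * l) = colour D y" using quarter[OF y m] by simp
  moreover have "colour D z = colour D y"
    using quarter[OF y gauss_multiples_zero] by (simp add: y_def)
  ultimately show ?thesis by simp
qed

text \<open>
  Inverting 2 modulo \<open>u = p + q\<i>\<close>: the norm \<open>N = u * cnj u\<close> is odd, so \<open>y = (1 + N)/2 * x\<close>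
  is a Gaussian integer, and \<open>2y = x + Nx\<close> is congruent to \<open>x\<close> modulo \<open>u\<close>.
\<close>

lemma odd_gauss_congruence:
  fixes p q :: int
  assumes odd: "odd (p + q)" and x: "is_cell_centre x"
  obtains y l where "is_cell_centre y" "l \<in> gauss_multiples (Complex (of_int p) (of_int q))"
    "2 * y = x + l"
proof -
  define u where "u = Complex (of_int p) (of_int q)"
  have u: "is_cell_centre u" by (simp add: u_def)
  have "even (1 + p\<^sup>2 + q\<^sup>2)" using odd by simp
  then obtain h where h: "1 + p\<^sup>2 + q\<^sup>2 = 2 * h" by (rule evenE)
  have "1 + u * cnj u = of_int (1 + p\<^sup>2 + q\<^sup>2)"
    by (simp add: u_def complex_eq_iff power2_eq_square)
  then have norm: "1 + u * cnj u = of_int (2 * h)" by (simp only: h)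
  have "2 * (of_int h * x) = of_int (2 * h) * x" by simp
  also have "\<dots> = x + u * (cnj u * x)" unfolding norm[symmetric] by (simp add: distrib_right)
  finally have eq: "2 * (of_int h * x) = x + u * (cnj u * x)" .
  show ?thesis
  proof (rule that)
    show "is_cell_centre (of_int h * x)" using x by simp
    show "u * (cnj u * x) \<in> gauss_multiples (Complex (of_int p) (of_int q))"
      unfolding u_def[symmetric] using x u by (intro gauss_multiplesI) simp
  qed (rule eq)
qed

text \<open>
  The map \<open>z \<mapsto> 2z + w\<close> carries the quarter-turn about \<open>c'\<close> to that about \<open>2c' + w\<close> and a
  translation by \<open>m\<close> to one by \<open>2m\<close>. The centre \<open>c'\<close> is chosen so that \<open>2c' + w\<close> is exactly
  one of the given centres \<open>c + l\<close>, and the translations by \<open>2m\<close> are periods of \<open>D\<close>.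
\<close>

lemma halving_turn_group:
  fixes p q :: int
  assumes c: "is_cell_centre c" and "odd (p + q)" and u: "u = Complex (of_int p) (of_int q)"
    and quarter: "\<And>z l. is_cell_centre z \<Longrightarrow> l \<in> gauss_multiples u \<Longrightarrow>
                    colour D (c + l + \<i> * (z - (c + l))) = colour D z"
  obtains c' where "is_cell_centre c'" "turn_group c' u \<subseteq> symmetries (halving a b D)"
proof -
  have u': "is_cell_centre u" by (simp add: u)
  define w where "w = Complex (of_int a) (of_int b)"
  have w: "is_cell_centre w" by (simp add: w_def)
  have "is_cell_centre (c - w)" using c w by blast
  then obtain c' l where c': "is_cell_centre c'" and l: "l \<in> gauss_multiples u" and "2 * c' = c - w + l"
    using odd_gauss_congruence[OF \<open>odd (p + q)\<close>, of "c - w"] unfolding u by blast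
  then have centre: "c + l = 2 * c' + w" by (simp add: algebra_simps)
  have cc: "is_cell_centre (2 * z + w)" if "is_cell_centre z" for z
    using that w by (intro cell_centre_closed) simp_all
  have "turn_group c' u \<subseteq> symmetries (halving a b D)"
  proof (rule turn_group_symmetries[OF c' u'])
    fix z assume z: "is_cell_centre z"
    have "2 * (c' + \<i> * (z - c')) + w = c + l + \<i> * (2 * z + w - (c + l))"
      unfolding centre by (simp add: algebra_simps)
    moreover have "is_cell_centre (c' + \<i> * (z - c'))" using c' z by blast
    ultimately show "colour (halving a b D) (c' + \<i> * (z - c')) = colour (halving a b D) z"
      using quarter[OF cc[OF z] l] z by (simp add: colour_halving flip: w_def)
    fix m assume m: "m \<in> gauss_multiples u"
    have "is_cell_centre (z + m)" using z gauss_multiples_cell_centre[OF u' m] by blast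
    then show "colour (halving a b D) (z + m) = colour (halving a b D) z"
      using quarter_turn_colour_period[OF c u' quarter cc[OF z] m] z
      by (simp add: colour_halving add_ac distrib_left flip: w_def)
  qed
  then show ?thesis using c' that by blast
qed


section \<open>Quarter-turns of the three species\<close>

text \<open>
  A quarter-turn about \<open>c\<close> followed by the translation by \<open>t\<close> has its fixed point at
  \<open>c + t/(1 - \<i>) = c + (1 + \<i>)t/2\<close>. For the clockwise turn the translation by \<open>\<i>t\<close> leads to
  the same point, as \<open>\<i>/(1 + \<i>) = (1 + \<i>)/2\<close>.
\<close>

lemma lattice_unit_quarter_turns:
  assumes p4: "type_p4 \<Gamma>" and unit: "lattice_unit \<Gamma> c u" and t: "t \<in> gauss_multiples u"
  shows "\<exists>g\<in>\<Gamma>. is_quarter_turn (c + (1 + \<i>) / 2 * t) g"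
proof -
  have comp: "g \<circ> h \<in> \<Gamma>" if "g \<in> \<Gamma>" "h \<in> \<Gamma>" for g h
    using p4 that unfolding type_p4_def by (auto dest: subgroup.m_closed simp: isometry_group_def)
  have translation: "turn 0 l \<in> \<Gamma>" if "l \<in> gauss_multiples u" for l
    using unit that
    by (auto simp: lattice_unit_def int_span_eq_gauss_multiples translation_vectors_def
             simp flip: translation_eq)
  obtain g where g: "g \<in> \<Gamma>" "is_quarter_turn c g"
    using unit by (auto simp: lattice_unit_def square_corners_def)
  from g(2)[unfolded quarter_turn_iff] show ?thesis
  proof
    assume g1: "g = turn 1 (c - \<i> * c)"
    have "turn 0 t \<circ> g = turn 1 (c - \<i> * c + t)"
      by (simp add: g1 turn_comp)
    also have "c - \<i> * c + t = c + (1 + \<i>) / 2 * t - \<i> * (c + (1 + \<i>) / 2 * t)"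
      by (simp add: field_simps)
    finally have "is_quarter_turn (c + (1 + \<i>) / 2 * t) (turn 0 t \<circ> g)"
      unfolding quarter_turn_iff by (rule disjI1)
    then show ?thesis using comp[OF translation[OF t] g(1)] by (rule bexI)
  next
    assume g3: "g = turn 3 (c + \<i> * c)"
    have it: "\<i> * t \<in> gauss_multiples u" using t by (intro gauss_multiples_mult) simp_all
    have "turn 0 (\<i> * t) \<circ> g = turn 3 (c + \<i> * c + \<i> * t)"
      by (simp add: g3 turn_comp)
    also have "c + \<i> * c + \<i> * t = c + (1 + \<i>) / 2 * t + \<i> * (c + (1 + \<i>) / 2 * t)"
      by (simp add: field_simps)
    finally have "is_quarter_turn (c + (1 + \<i>) / 2 * t) (turn 0 (\<i> * t) \<circ> g)"
      unfolding quarter_turn_iff by (rule disjI2)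
    then show ?thesis using comp[OF translation[OF it] g(1)] by (rule bexI)
  qed
qed

definition cell_quarter_turns :: "design \<Rightarrow> complex \<Rightarrow> complex \<Rightarrow> bool" where
  "cell_quarter_turns D c u \<longleftrightarrow> is_cell_centre c \<and>
     (\<forall>l\<in>gauss_multiples u. \<exists>g\<in>planar_projection (symmetries D). is_quarter_turn (c + l) g)"

text \<open>
  If the corners of the unit are cell corners, its centre \<open>c + (1 + \<i>)u/2\<close> is a cell centre:
  both coordinates of \<open>(1 + \<i>)u\<close>, namely \<open>p - q\<close> and \<open>p + q\<close>, are odd.
\<close>

lemma level1_cell_quarter_turns:
  assumes p4: "type_p4 (planar_projection (symmetries D))"
    and unit: "lattice_unit (planar_projection (symmetries D)) c u" and "level1_unit c u"
  shows "\<exists>c. cell_quarter_turns D c u"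
proof -
  have turns: "\<exists>g\<in>planar_projection (symmetries D). is_quarter_turn z g"
    if "l \<in> gauss_multiples u" "z = c + (1 + \<i>) / 2 * l" for l z
    using lattice_unit_quarter_turns[OF p4 unit] that by blast
  have cancel: "(1 + \<i>) / 2 * ((1 - \<i>) * l) = l" for l
    by (simp add: field_simps)
  consider "is_cell_centre c" | "is_cell_corner c"
    using \<open>level1_unit c u\<close> by (auto simp: level1_unit_def square_corners_def)
  then show ?thesis
  proof cases
    case 1
    have "\<exists>g\<in>planar_projection (symmetries D). is_quarter_turn (c + l) g"
      if "l \<in> gauss_multiples u" for l
    proof (rule turns)
      show "(1 - \<i>) * l \<in> gauss_multiples u" using that by blast
    qed (simp only: cancel)
    then show ?thesis using 1 by (auto simp: cell_quarter_turns_def)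
  next
    case 2
    define m where "m = c + (1 + \<i>) / 2 * u"
    obtain p q :: nat where pq: "odd (p + q)" "u = Complex (of_nat p) (of_nat q)"
      using \<open>level1_unit c u\<close> by (auto simp: level1_unit_def)
    \<comment> \<open>The half-integral parts of the coordinates of \<open>c\<close> and of \<open>(1 + \<i>)u/2\<close> cancel.\<close>
    obtain h where h: "p + q = 2 * h + 1" using pq(1) by (rule oddE)
    have q: "real q = 2 * of_nat h + 1 - real p"
      using arg_cong[OF h, of real] by simp
    have "Re m = Re c - 1/2 + of_int (int p - int h)" "Im m = Im c - 1/2 + of_int (int h + 1)"
      by (simp_all add: m_def pq q field_simps)
    moreover have "Re c - 1/2 \<in> \<int>" "Im c - 1/2 \<in> \<int>" using 2 by (simp_all add: is_cell_corner_def)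
    ultimately have "is_cell_centre m" unfolding is_cell_centre_def by (metis Ints_add Ints_of_int)
    moreover have "\<exists>g\<in>planar_projection (symmetries D). is_quarter_turn (m + l) g"
      if "l \<in> gauss_multiples u" for l
    proof (rule turns)
      have "u * 1 \<in> gauss_multiples u" by blast
      then have "u \<in> gauss_multiples u" by simp
      then show "u + (1 - \<i>) * l \<in> gauss_multiples u" using that by blast
      show "m + l = c + (1 + \<i>) / 2 * (u + (1 - \<i>) * l)"
        unfolding distrib_left cancel by (simp add: m_def)
    qed
    ultimately show ?thesis by (auto simp: cell_quarter_turns_def)
  qed
qed

text \<open>
  Two mid-points of sides of a square with side vector \<open>u\<close> differ by a multiple of
  \<open>(1 + \<i>)u/2\<close>, so \<open>u'\<close> is such a multiple. Hence the points \<open>c + u'x\<close> are among the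
  points \<open>c + (1 + \<i>)t/2\<close> with \<open>t\<close> in the lattice, the corners and centres of the units.
\<close>

lemma level2_cell_quarter_turns:
  assumes p4: "type_p4 (planar_projection (symmetries D))"
    and unit: "lattice_unit (planar_projection (symmetries D)) c u"
    and c: "is_cell_centre c"
    and mid: "square_midpoints c u = square_corners c' u'"
  shows "cell_quarter_turns D c u'"
proof -
  have "c' \<in> square_midpoints c u" "c' + u' \<in> square_midpoints c u"
    by (simp_all add: mid square_corners_def)
  \<comment> \<open>Mid-points in units of \<open>u/2\<close>, seen from \<open>c\<close>: their differences are multiples of \<open>1 + \<i>\<close>.\<close>
  moreover have "square_midpoints c u = (\<lambda>x. c + u / 2 * x) ` {1, 2 + \<i>, 1 + 2 * \<i>, \<i>}"
    by (simp add: square_midpoints_def midpoint_def scaleR_conv_of_real field_simps)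
  ultimately obtain x y where xy: "x \<in> {1, 2 + \<i>, 1 + 2 * \<i>, \<i>}" "y \<in> {1, 2 + \<i>, 1 + 2 * \<i>, \<i>}"
    "c' = c + u / 2 * x" "c' + u' = c + u / 2 * y" by (auto simp only: image_iff)
  then have "u' = u / 2 * (y - x)" by (simp add: algebra_simps)
  moreover have "\<exists>d. is_cell_centre d \<and> y - x = (1 + \<i>) * d"
  proof (intro exI conjI)
    show "is_cell_centre ((1 - \<i>) / 2 * (y - x))"
      using xy(1,2) by (auto simp: is_cell_centre_def)
    show "y - x = (1 + \<i>) * ((1 - \<i>) / 2 * (y - x))"
      by (simp add: field_simps)
  qed
  ultimately obtain x where x: "is_cell_centre x" "u' = (1 + \<i>) / 2 * (u * x)"
    by (auto simp: field_simps)
  have "\<exists>g\<in>planar_projection (symmetries D). is_quarter_turn (c + l) g"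
    if l: "l \<in> gauss_multiples u'" for l
  proof -
    obtain y where y: "is_cell_centre y" "l = u' * y" using l by (auto simp: gauss_multiples_def)
    have "u * (x * y) \<in> gauss_multiples u" using x y by blast
    then show ?thesis
      using lattice_unit_quarter_turns[OF p4 unit, of "u * (x * y)"] by (simp add: x y mult.assoc)
  qed
  then show ?thesis using c by (simp add: cell_quarter_turns_def)
qed

lemma species_cell_quarter_turns:
  assumes "species_36_1 D \<or> species_36_s D \<or> species_39 D"
  obtains c c' u where "level1_unit c' u" "cell_quarter_turns D c u"
  using assms
proof (elim disjE)
  let ?G\<^sub>1 = "planar_projection (symmetries D)"
  assume "species_36_1 D"
  then obtain c u where p4: "type_p4 ?G\<^sub>1" and u: "level1_unit c u" "lattice_unit ?G\<^sub>1 c u"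
    unfolding species_36_1_def roth_type_36_1_def by (elim conjE exE)
  obtain c' where "cell_quarter_turns D c' u"
    using level1_cell_quarter_turns[OF p4 u(2,1)] by (elim exE)
  with u(1) show ?thesis by (rule that)
next
  let ?G\<^sub>1 = "planar_projection (symmetries D)"
  assume "species_39 D"
  then obtain c u where p4: "type_p4 ?G\<^sub>1" and u: "level1_unit c u" "lattice_unit ?G\<^sub>1 c u"
    unfolding species_39_def by (elim conjE exE)
  obtain c' where "cell_quarter_turns D c' u"
    using level1_cell_quarter_turns[OF p4 u(2,1)] by (elim exE)
  with u(1) show ?thesis by (rule that)
next
  let ?G\<^sub>1 = "planar_projection (symmetries D)"
  assume "species_36_s D"
  then obtain c u where p4: "type_p4 ?G\<^sub>1" and u: "level2_unit c u" "lattice_unit ?G\<^sub>1 c u"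
    and corners: "\<forall>z\<in>square_corners c u. is_cell_centre z"
    unfolding species_36_s_def by (elim conjE exE)
  have c: "is_cell_centre c" using corners by (simp add: square_corners_def)
  obtain c' u' where u': "level1_unit c' u'" "square_midpoints c u = square_corners c' u'"
    using u(1) unfolding level2_unit_def by (elim conjE exE)
  have "cell_quarter_turns D c u'"
    using p4 u(2) c u'(2) by (rule level2_cell_quarter_turns)
  with u'(1) show ?thesis by (rule that)
qed

lemma species_reversing:
  assumes "species_36_1 D \<or> species_36_s D \<or> species_39 D"
    and "(g, \<epsilon>) \<in> symmetries D" "is_quarter_turn z g" "is_cell_centre z"
  shows "\<epsilon> = Reversing"
  using assms(1)
proof (elim disjE)
  assume "species_36_1 D"
  then have "\<forall>(g, \<epsilon>)\<in>symmetries D. \<forall>z. is_quarter_turn z g \<longrightarrow> \<epsilon> = Reversing"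
    unfolding species_36_1_def roth_type_36_1_def by (elim conjE exE)
  from bspec[OF this assms(2)] show ?thesis using assms(3) by auto
next
  assume "species_36_s D"
  then have "\<forall>(g, \<epsilon>)\<in>symmetries D. \<forall>z. is_quarter_turn z g \<longrightarrow> \<epsilon> = Reversing"
    unfolding species_36_s_def by (elim conjE)
  from bspec[OF this assms(2)] show ?thesis using assms(3) by auto
next
  assume "species_39 D"
  then have "\<forall>(g, \<epsilon>)\<in>symmetries D. \<forall>z. is_quarter_turn z g \<longrightarrow>
      (is_cell_centre z \<longrightarrow> \<epsilon> = Reversing) \<and> (is_cell_corner z \<longrightarrow> \<epsilon> = Preserving)"
    unfolding species_39_def by (elim conjE)
  from bspec[OF this assms(2)] show ?thesis using assms(3,4) by simp
qed

theorem theorem9: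
  fixes D :: design
  assumes "isonemal D" and "is_fabric D"
    and "species_36_1 D \<or> species_36_s D \<or> species_39 D"
  shows "\<forall>a\<in>{0, 1}. \<forall>b\<in>{0, 1}.
           isonemal (halving a b D) \<and>
           (\<exists>H. H \<subseteq> symmetries (halving a b D) \<and> roth_type_36_1 H)"
proof (intro ballI)
  fix a b :: int
  obtain c c0 u where unit: "level1_unit c0 u" and turns: "cell_quarter_turns D c u"
    using species_cell_quarter_turns[OF assms(3)] .
  obtain p q :: nat where pq: "coprime p q" "odd (p + q)"
    and "u = Complex (of_nat p) (of_nat q)"
    using unit unfolding level1_unit_def by (elim conjE exE)
  then have u: "u = Complex (of_int (int p)) (of_int (int q))" by simp
  then have u': "is_cell_centre u" by (simp only: cell_centre_Complex)
  have c: "is_cell_centre c" using turns by (simp add: cell_quarter_turns_def)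
  have quarter: "colour D (c + l + \<i> * (z - (c + l))) = colour D z"
    if z: "is_cell_centre z" and l: "l \<in> gauss_multiples u" for z l
  proof -
    obtain g \<epsilon> where g: "(g, \<epsilon>) \<in> symmetries D" "is_quarter_turn (c + l) g"
      using turns l unfolding cell_quarter_turns_def planar_projection_def
      by (metis (no_types) imageE prod.collapse)
    have cl: "is_cell_centre (c + l)" using c gauss_multiples_cell_centre[OF u' l] by simp
    have "\<epsilon> = Reversing" using assms(3) g cl by (rule species_reversing)
    with g(1) have "(g, Reversing) \<in> symmetries D" by simp
    with cl g(2) show ?thesis using z by (rule reversing_quarter_turn_colour)
  qed
  have "odd (int p + int q)" using pq(2) by simp
  then obtain c' where c': "is_cell_centre c'" and sub: "turn_group c' u \<subseteq> symmetries (halving a b D)"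
    using halving_turn_group[OF c _ u quarter] by auto
  have "coprime (int p) (int q)" using pq(1) by simp
  then have isonemal: "isonemal (halving a b D)" by (rule isonemal_if_turn_group[OF c' _ u sub])
  have "\<forall>z\<in>square_corners c' u. is_cell_centre z"
    using c' u' by (simp add: square_corners_def)
  then have "level1_unit c' u" using unit by (simp add: level1_unit_def)
  then have "roth_type_36_1 (turn_group c' u)" by (rule turn_group_roth_type_36_1[OF c' u'])
  with isonemal sub show "isonemal (halving a b D) \<and>
      (\<exists>H. H \<subseteq> symmetries (halving a b D) \<and> roth_type_36_1 H)" by (intro conjI exI)
qed

end
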